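(* Let $0<p\le 1$ with $p\ne\frac12$, let $q=1-p$, and let $X_{n,s}$ be the number of turns required to end the single-player pile game with boundary with set of choices $R=\{1,-1\}$ and target $n$, starting with $s$ chips, $0\le s\le n$. Then $$E[X_{n,s}]=\frac{(2p-1)n+q\left(\frac{q}{p}\right)^n-\left[(2p-1)s+q\left(\frac{q}{p}\right)^s\right]}{(2p-1)^2}.$$
   Context: Single-player pile game with boundary, $R=\{1,-1\}$: the player starts with $s$ chips, $0\le s\le n$. In each turn, independently, with probability $p$ one chip is added, and with probability $q=1-p$ one chip is removed, except that if the player has $0$ chips he stays at $0$ instead. The game ends when the player first has $n$ chips (at turn $0$ if $s=n$). *)

theory Defs
  imports "HOL-Probability.Probability"
begin

text \<open>
  Turn \<open>t\<close> (counted from 0) draws the choice \<open>\<xi> t \<omega>\<close> from \<open>{1, -1}\<close>.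
  Removing a chip from an empty pile leaves it empty.
\<close>

primrec chips :: "(nat \<Rightarrow> 'a \<Rightarrow> int) \<Rightarrow> nat \<Rightarrow> 'a \<Rightarrow> nat \<Rightarrow> nat" where
  "chips \<xi> s \<omega> 0 = s"
| "chips \<xi> s \<omega> (Suc t) =
     (if chips \<xi> s \<omega> t = 0 \<and> \<xi> t \<omega> = -1 then 0
      else nat (int (chips \<xi> s \<omega> t) + \<xi> t \<omega>))"

text \<open>
  The number of turns needed to end the game. It is \<open>\<infinity>\<close>, the infimum of the empty set,
  if the target is never reached. The recursion above also runs past the end of the game,
  which does not affect the first hitting time.
\<close>

definition turns :: "(nat \<Rightarrow> 'a \<Rightarrow> int) \<Rightarrow> nat \<Rightarrow> nat \<Rightarrow> 'a \<Rightarrow> enat" where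
  "turns \<xi> n s \<omega> = (INF t \<in> {t. chips \<xi> s \<omega> t = n}. enat t)"

text \<open>
  Expectation of an extended natural random variable, with values in \<open>[0, \<infinity>]\<close>. The result is
  an \<^typ>\<open>ereal\<close> so that equating it with a real number involves no truncation at 0.
\<close>

definition expected_value :: "'a measure \<Rightarrow> ('a \<Rightarrow> enat) \<Rightarrow> ereal" where
  "expected_value M X = enn2ereal (\<integral>\<^sup>+ \<omega>. ennreal_of_enat (X \<omega>) \<partial>M)"

end

theory Submission
  imports Defs
begin

text \<open>
  Let \<open>f k\<close> be the claimed expectation from \<open>k\<close> chips. It satisfies the first-step equation
  \<open>f k = 1 + p f (k + 1) + q f (k - 1)\<close>, at \<open>k = 0\<close> as well if subtraction is truncated, together
  with \<open>f n = 0\<close>. Let \<open>W t\<close> be the expectation of \<open>f\<close> at the pile after \<open>t\<close> turns, restricted to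
  the event that the game is still running. Then \<open>W (t + 1) = W t - P (turns > t)\<close>, so that the
  partial sums of \<open>P (turns > t)\<close> are \<open>f s - W t\<close>. Since \<open>f\<close> is nonnegative and bounded on
  \<open>{..n}\<close>, the sum converges, hence \<open>P (turns > t)\<close> and with it \<open>W t\<close> tend to 0.
\<close>

section \<open>The closed form: first-step equation and monotonicity\<close>

definition mean_turns :: "real \<Rightarrow> nat \<Rightarrow> nat \<Rightarrow> real" where
  "mean_turns p n k =
    ((2 * p - 1) * real n + (1 - p) * ((1 - p) / p) ^ n
      - ((2 * p - 1) * real k + (1 - p) * ((1 - p) / p) ^ k)) / (2 * p - 1)\<^sup>2"

lemma mean_turns_target [simp]: "mean_turns p n n = 0"
  by (simp add: mean_turns_def)

text \<open>Only the bracket \<open>h\<close> depends on \<open>k\<close>. One turn raises its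
  linear part by \<open>(2 * p - 1)\<^sup>2\<close> on average and preserves its geometric part,
  since \<open>(1 - p) / p\<close> is a root of \<open>p * x\<^sup>2 - x + (1 - p)\<close>. The
  factor \<open>1 - p\<close> of the geometric part makes the equation hold at the boundary
  too.\<close>

lemma mean_turns_step:
  assumes "0 < p" "p \<noteq> 1 / 2"
  shows "mean_turns p n k = 1 + p * mean_turns p n (Suc k) + (1 - p) * mean_turns p n (k - 1)"
proof -
  define C where "C = (2 * p - 1) * real n + (1 - p) * ((1 - p) / p) ^ n"
  define d where "d = (2 * p - 1)\<^sup>2"
  have d: "d \<noteq> 0" using assms by (simp add: d_def)
  define h where "h j = (2 * p - 1) * real j + (1 - p) * ((1 - p) / p) ^ j" for j :: nat
  have f: "mean_turns p n j = (C - h j) / d" for j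
    by (simp add: mean_turns_def C_def h_def d_def)
  have h: "p * h (Suc k) + (1 - p) * h (k - 1) = h k + d"
  proof (cases k)
    case 0
    then show ?thesis
      using assms by (simp add: h_def d_def field_simps power2_eq_square)
  next
    case (Suc j)
    define r where "r = (1 - p) / p"
    have r: "p * r = 1 - p" using assms by (simp add: r_def)
    have hr: "h i = (2 * p - 1) * real i + (1 - p) * r ^ i" for i
      by (simp add: h_def r_def)
    \<comment> \<open>The root property of \<open>r\<close>, scaled by \<open>y\<close>; taking
      \<open>y = r ^ j\<close> and multiplying by \<open>1 - p\<close> yields the geometric terms of
      \<open>h\<close>.\<close>
    have "p * (r * (r * y)) + (1 - p) * y = r * y" for y
      using r by algebra
    from this[of "r ^ j"] have "(1 - p) * (p * (r * (r * r ^ j)) + (1 - p) * r ^ j) = (1 - p) * (r * r ^ j)"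
      by simp
    then show ?thesis
      by (simp add: hr Suc d_def algebra_simps power2_eq_square)
  qed
  have "1 + p * mean_turns p n (Suc k) + (1 - p) * mean_turns p n (k - 1)
      = (d + C - (p * h (Suc k) + (1 - p) * h (k - 1))) / d"
    using d by (simp add: f field_simps)
  also have "\<dots> = mean_turns p n k"
    unfolding h by (simp add: f)
  finally show ?thesis by simp
qed

text \<open>The drops \<open>D k = f k - f (k + 1)\<close> satisfy \<open>p * D 0 = 1\<close> and
  \<open>p * D (k + 1) = 1 + (1 - p) * D k\<close>, so they stay positive. With
  \<open>f n = 0\<close> this gives the bounds on \<open>f\<close> over
  \<open>{..n}\<close>.\<close>

lemma mean_turns_Suc_le:
  assumes "0 < p" "p \<le> 1" "p \<noteq> 1 / 2"
  shows "mean_turns p n (Suc k) \<le> mean_turns p n k"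
proof (induction k)
  case 0
  have "p * (mean_turns p n 0 - mean_turns p n (Suc 0)) = 1"
    using mean_turns_step[OF assms(1,3), of n 0] by (simp add: algebra_simps)
  then have "0 < p * (mean_turns p n 0 - mean_turns p n (Suc 0))"
    by simp
  then show ?case
    using assms by (simp add: zero_less_mult_iff)
next
  case (Suc k)
  have "p * (mean_turns p n (Suc k) - mean_turns p n (Suc (Suc k)))
      = 1 + (1 - p) * (mean_turns p n k - mean_turns p n (Suc k))"
    using mean_turns_step[OF assms(1,3), of n "Suc k"] by (simp add: algebra_simps)
  moreover have "0 \<le> (1 - p) * (mean_turns p n k - mean_turns p n (Suc k))"
    using Suc assms by simp
  ultimately have "0 < p * (mean_turns p n (Suc k) - mean_turns p n (Suc (Suc k)))"
    by linarith
  then show ?case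
    using assms by (simp add: zero_less_mult_iff)
qed

lemma mean_turns_antimono:
  assumes "0 < p" "p \<le> 1" "p \<noteq> 1 / 2" "j \<le> k"
  shows "mean_turns p n k \<le> mean_turns p n j"
  by (rule lift_Suc_antimono_le[of "mean_turns p n" j k]) (use mean_turns_Suc_le assms in auto)

section \<open>Pathwise facts about the pile and the hitting time\<close>

lemma less_turns_iff: "enat t < turns \<xi> n s \<omega> \<longleftrightarrow> (\<forall>u\<le>t. chips \<xi> s \<omega> u \<noteq> n)"
proof -
  have "turns \<xi> n s \<omega> \<le> enat t \<longleftrightarrow> (\<exists>u\<le>t. chips \<xi> s \<omega> u = n)"
  proof
    assume le: "turns \<xi> n s \<omega> \<le> enat t"
    \<comment> \<open>A finite value rules out the empty set, whose infimum is
      \<open>\<infinity>\<close>; on a nonempty set the infimum is attained.\<close>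
    then obtain t' where "chips \<xi> s \<omega> t' = n"
      by (auto simp: turns_def Inf_enat_def split: if_splits)
    then have "turns \<xi> n s \<omega> \<in> enat ` {t. chips \<xi> s \<omega> t = n}"
      unfolding turns_def by (intro wellorder_InfI[of "enat t'"]) blast
    then show "\<exists>u\<le>t. chips \<xi> s \<omega> u = n"
      using le by auto
  next
    assume "\<exists>u\<le>t. chips \<xi> s \<omega> u = n"
    then show "turns \<xi> n s \<omega> \<le> enat t"
      unfolding turns_def by (auto intro: INF_lower2)
  qed
  then show ?thesis by (auto simp: not_le[symmetric])
qed

text \<open>Choice \<open>i\<close> first affects the pile at time \<open>i + 1\<close>. So the pile
  up to time \<open>t\<close> is a function of the path of choices before turn \<open>t\<close>,
  read off by the coordinate maps.\<close>

lemma chips_restrict: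
  "u \<le> t \<Longrightarrow> chips (\<lambda>i w. w i) s (restrict (\<lambda>i. \<xi> i \<omega>) {..<t}) u = chips \<xi> s \<omega> u"
  by (induction u) auto

lemma measurable_chips:
  assumes "\<And>i. i < t \<Longrightarrow> \<xi> i \<in> M \<rightarrow>\<^sub>M count_space UNIV"
  shows "u \<le> t \<Longrightarrow> (\<lambda>\<omega>. chips \<xi> s \<omega> u) \<in> M \<rightarrow>\<^sub>M count_space UNIV"
proof (induction u)
  case (Suc u)
  have [measurable]: "\<xi> u \<in> M \<rightarrow>\<^sub>M count_space UNIV"
    "(\<lambda>\<omega>. chips \<xi> s \<omega> u) \<in> M \<rightarrow>\<^sub>M count_space UNIV"
    using Suc assms by auto
  show ?case by simp
qed simp

text \<open>Truncated subtraction absorbs the boundary rule, matching the \<open>k - 1\<close> in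
  the first-step equation.\<close>

lemma chips_Suc_unit:
  assumes "\<xi> t \<omega> = 1 \<or> \<xi> t \<omega> = -1"
  shows "chips \<xi> s \<omega> (Suc t) =
    (if \<xi> t \<omega> = 1 then Suc (chips \<xi> s \<omega> t) else chips \<xi> s \<omega> t - 1)"
  using assms by auto

text \<open>The pile rises by at most one per turn, so it cannot jump over the target.\<close>

lemma chips_below_target_iff:
  assumes "\<And>i. \<xi> i \<omega> = 1 \<or> \<xi> i \<omega> = -1" "s \<le> n"
  shows "(\<forall>u\<le>t. chips \<xi> s \<omega> u < n) \<longleftrightarrow> (\<forall>u\<le>t. chips \<xi> s \<omega> u \<noteq> n)"
proof
  assume ne: "\<forall>u\<le>t. chips \<xi> s \<omega> u \<noteq> n"
  have "u \<le> t \<Longrightarrow> chips \<xi> s \<omega> u < n" for u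
  proof (induction u)
    case 0
    then show ?case using ne assms(2) by force
  next
    case (Suc u)
    have "chips \<xi> s \<omega> (Suc u) \<le> n"
      using Suc chips_Suc_unit[of \<xi> u \<omega> s] assms(1)[of u] by auto
    then show ?case using ne Suc.prems le_neq_implies_less by blast
  qed
  then show "\<forall>u\<le>t. chips \<xi> s \<omega> u < n" by blast
qed auto

section \<open>Independence of a turn from its past\<close>

text \<open>The two factors depend on the disjoint index sets \<open>{..<t}\<close> and
  \<open>{t}\<close>, hence are independent; the bounds supply the integrability that the product
  rule requires.\<close>

lemma (in prob_space) expectation_past_times_present:
  fixes g :: "(nat \<Rightarrow> 'b) \<Rightarrow> real" and h :: "'b \<Rightarrow> real"
  assumes indep: "indep_vars (\<lambda>_. N) \<xi> UNIV"
    and g: "g \<in> borel_measurable (PiM {..<t} (\<lambda>_. N))" and h: "h \<in> borel_measurable N"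
    and bdd: "\<And>w. \<bar>g w\<bar> \<le> B" "\<And>x. \<bar>h x\<bar> \<le> C"
  shows "expectation (\<lambda>\<omega>. g (restrict (\<lambda>i. \<xi> i \<omega>) {..<t}) * h (\<xi> t \<omega>)) =
    expectation (\<lambda>\<omega>. g (restrict (\<lambda>i. \<xi> i \<omega>) {..<t})) * expectation (\<lambda>\<omega>. h (\<xi> t \<omega>))"
proof -
  have "indep_var (PiM {..<t} (\<lambda>_. N)) (\<lambda>\<omega>. restrict (\<lambda>i. \<xi> i \<omega>) {..<t})
      (PiM {t} (\<lambda>_. N)) (\<lambda>\<omega>. restrict (\<lambda>i. \<xi> i \<omega>) {t})"
    by (rule indep_var_restrict[OF indep]) auto
  then have "indep_var borel (g \<circ> (\<lambda>\<omega>. restrict (\<lambda>i. \<xi> i \<omega>) {..<t}))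
      borel ((\<lambda>w. h (w t)) \<circ> (\<lambda>\<omega>. restrict (\<lambda>i. \<xi> i \<omega>) {t}))"
    by (rule indep_var_compose) (use g h in measurable)
  then have iv: "indep_var borel (\<lambda>\<omega>. g (restrict (\<lambda>i. \<xi> i \<omega>) {..<t})) borel (\<lambda>\<omega>. h (\<xi> t \<omega>))"
    by (simp add: o_def)
  have "integrable M (\<lambda>\<omega>. g (restrict (\<lambda>i. \<xi> i \<omega>) {..<t}))"
    using bdd(1) indep_var_rv1[OF iv] by (intro integrable_const_bound[where B = B]) auto
  moreover have "integrable M (\<lambda>\<omega>. h (\<xi> t \<omega>))"
    using bdd(2) indep_var_rv2[OF iv] by (intro integrable_const_bound[where B = C]) auto
  ultimately show ?thesis
    by (intro indep_var_lebesgue_integral iv)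
qed

section \<open>The random game and the remaining expectation\<close>

locale pile_game = prob_space +
  fixes \<xi> :: "nat \<Rightarrow> 'a \<Rightarrow> int" and p :: real and n s :: nat
  assumes p: "0 < p" "p \<le> 1" "p \<noteq> 1 / 2"
    and indep: "indep_vars (\<lambda>_. count_space UNIV) \<xi> UNIV"
    and up: "\<And>t. prob {\<omega> \<in> space M. \<xi> t \<omega> = 1} = p"
    and down: "\<And>t. prob {\<omega> \<in> space M. \<xi> t \<omega> = -1} = 1 - p"
    and start: "s \<le> n"
begin

abbreviation (input) f :: "nat \<Rightarrow> real" where "f \<equiv> mean_turns p n"

text \<open>Stated with \<open>< n\<close> instead of \<open>\<noteq> n\<close>, so that
  \<open>f\<close> is bounded on this event everywhere, even on the null set where some choice is
  not 1 or -1.\<close>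

definition running :: "nat \<Rightarrow> 'a \<Rightarrow> bool" where
  "running t \<omega> \<longleftrightarrow> (\<forall>u\<le>t. chips \<xi> s \<omega> u < n)"

text \<open>The \<open>W t\<close> of the overview. As \<open>f n = 0\<close>, it is almost surely
  the integrand of the pile stopped at the target.\<close>

definition remaining :: "nat \<Rightarrow> real" where
  "remaining t = expectation (\<lambda>\<omega>. if running t \<omega> then f (chips \<xi> s \<omega> t) else 0)"

lemma measurable_choice [measurable]: "\<xi> t \<in> M \<rightarrow>\<^sub>M count_space UNIV"
  using indep unfolding indep_vars_def by auto

lemma measurable_pile [measurable]: "(\<lambda>\<omega>. chips \<xi> s \<omega> t) \<in> M \<rightarrow>\<^sub>M count_space UNIV"
  by (rule measurable_chips[where t = t]) auto

lemma measurable_running [measurable]: "Measurable.pred M (running t)"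
  unfolding running_def by measurable

lemma AE_choice_unit: "AE \<omega> in M. \<forall>t. \<xi> t \<omega> = 1 \<or> \<xi> t \<omega> = -1"
proof (subst AE_all_countable, intro allI)
  fix t
  have "prob {\<omega> \<in> space M. \<xi> t \<omega> = 1 \<or> \<xi> t \<omega> = -1}
      = prob ({\<omega> \<in> space M. \<xi> t \<omega> = 1} \<union> {\<omega> \<in> space M. \<xi> t \<omega> = -1})"
    by (intro arg_cong[where f = prob]) auto
  also have "\<dots> = 1"
    by (subst finite_measure_Union) (auto simp: up down)
  finally show "AE \<omega> in M. \<xi> t \<omega> = 1 \<or> \<xi> t \<omega> = -1"
    by (subst (asm) prob_Collect_eq_1) auto
qed

lemma f_bounds: "k \<le> n \<Longrightarrow> 0 \<le> f k" "f k \<le> f 0"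
  using mean_turns_antimono[OF p, of k n n] mean_turns_antimono[OF p, of 0 k n] by auto

lemma expectation_running_choice:
  assumes c: "prob {\<omega> \<in> space M. \<xi> t \<omega> = c} = r" and v: "\<And>k. k < n \<Longrightarrow> \<bar>v k\<bar> \<le> (B :: real)"
  shows "expectation (\<lambda>\<omega>. (if running t \<omega> then v (chips \<xi> s \<omega> t) else 0) * indicator {c} (\<xi> t \<omega>)) =
    expectation (\<lambda>\<omega>. if running t \<omega> then v (chips \<xi> s \<omega> t) else 0) * r"
proof -
  define X where "X = (\<lambda>i (w :: nat \<Rightarrow> int). w i)"
  define g where "g w = (if \<forall>u\<le>t. chips X s w u < n then v (chips X s w t) else 0)" for w
  let ?N = "PiM {..<t} (\<lambda>_. count_space UNIV) :: (nat \<Rightarrow> int) measure"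
  have "X i \<in> ?N \<rightarrow>\<^sub>M count_space UNIV" if "i < t" for i
    using that unfolding X_def by (intro measurable_component_singleton) simp
  note mc = measurable_chips[OF this]
  have [measurable]: "Measurable.pred ?N (\<lambda>w. \<forall>u\<in>{..t}. chips X s w u < n)"
  proof (rule pred_intros_finite)
    fix u assume "u \<in> {..t}"
    then have [measurable]: "(\<lambda>w. chips X s w u) \<in> ?N \<rightarrow>\<^sub>M count_space UNIV" using mc by auto
    show "Measurable.pred ?N (\<lambda>w. chips X s w u < n)" by measurable
  qed simp
  have [measurable]: "(\<lambda>w. chips X s w t) \<in> ?N \<rightarrow>\<^sub>M count_space UNIV" using mc by auto
  have gm: "g \<in> borel_measurable ?N"
    unfolding g_def Ball_def[symmetric] atMost_iff[symmetric] by measurable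
  \<comment> \<open>For \<open>n = 0\<close> the bound on \<open>v\<close> is vacuous and
    \<open>B\<close> may be negative; \<open>\<bar>B\<bar>\<close> also covers the value 0.\<close>
  have gb: "\<bar>g w\<bar> \<le> \<bar>B\<bar>" for w
    using v[of "chips X s w t"] by (auto simp: g_def intro: order_trans)
  have g: "g (restrict (\<lambda>i. \<xi> i \<omega>) {..<t}) = (if running t \<omega> then v (chips \<xi> s \<omega> t) else 0)" for \<omega>
    by (auto simp: g_def X_def running_def chips_restrict)
  have "expectation (\<lambda>\<omega>. indicator {c} (\<xi> t \<omega>) :: real)
      = expectation (indicator {\<omega> \<in> space M. \<xi> t \<omega> = c})"
    by (intro Bochner_Integration.integral_cong) (auto simp: indicator_def)
  then have e: "expectation (\<lambda>\<omega>. indicator {c} (\<xi> t \<omega>) :: real) = r"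
    by (simp add: c)
  have "expectation (\<lambda>\<omega>. g (restrict (\<lambda>i. \<xi> i \<omega>) {..<t}) * indicator {c} (\<xi> t \<omega>)) =
      expectation (\<lambda>\<omega>. g (restrict (\<lambda>i. \<xi> i \<omega>) {..<t})) * expectation (\<lambda>\<omega>. indicator {c} (\<xi> t \<omega>))"
    by (rule expectation_past_times_present[OF indep gm _ gb, where C = 1])
      (auto simp: indicator_def)
  then show ?thesis by (simp only: g e)
qed

text \<open>Splitting by the choice at turn \<open>t\<close>, which is independent of the past,
  replaces \<open>f\<close> at the new pile by \<open>p * f (k + 1) + (1 - p) * f (k - 1)\<close>,
  which is \<open>f k - 1\<close>.\<close>

lemma remaining_Suc: "remaining (Suc t) = remaining t - prob {\<omega> \<in> space M. running t \<omega>}"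
proof -
  let ?E = "\<lambda>v :: nat \<Rightarrow> real. \<lambda>\<omega>. if running t \<omega> then v (chips \<xi> s \<omega> t) else 0"
  have b: "\<bar>f (Suc k)\<bar> \<le> f 0" "\<bar>f (k - 1)\<bar> \<le> f 0" "\<bar>f k\<bar> \<le> f 0" if "k < n" for k
    using that f_bounds[of "Suc k"] f_bounds[of "k - 1"] f_bounds[of k] by auto
  have f0: "0 \<le> f 0" by (rule f_bounds) simp
  have intE: "integrable M (?E v)" "integrable M (\<lambda>\<omega>. ?E v \<omega> * indicator {c} (\<xi> t \<omega>))"
    if "\<And>k. k < n \<Longrightarrow> \<bar>v k\<bar> \<le> f 0" for v c
    by (rule integrable_const_bound[where B = "f 0"];
        use that f0 in \<open>auto simp: running_def indicator_def\<close>)+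
  note int = intE[of "\<lambda>k. f (Suc k)", OF b(1)] intE[of "\<lambda>k. f (k - 1)", OF b(2)] intE[of f, OF b(3)]
  have ae: "AE \<omega> in M. (if running (Suc t) \<omega> then f (chips \<xi> s \<omega> (Suc t)) else 0) =
      ?E (\<lambda>k. f (Suc k)) \<omega> * indicator {1} (\<xi> t \<omega>) + ?E (\<lambda>k. f (k - 1)) \<omega> * indicator {-1} (\<xi> t \<omega>)"
    using AE_choice_unit
  proof eventually_elim
    case (elim \<omega>)
    let ?k = "chips \<xi> s \<omega> t"
    have c: "chips \<xi> s \<omega> (Suc t) = (if \<xi> t \<omega> = 1 then Suc ?k else ?k - 1)"
      using elim by (intro chips_Suc_unit) auto
    have r: "running (Suc t) \<omega> \<longleftrightarrow> running t \<omega> \<and> chips \<xi> s \<omega> (Suc t) < n"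
      by (auto simp: running_def le_Suc_eq simp del: chips.simps)
    have k: "?k < n" if "running t \<omega>"
      using that by (simp add: running_def)
    \<comment> \<open>If turn \<open>t\<close> reaches the target, the left side is 0 because the
      game has ended, and the right side because \<open>f n = 0\<close>.\<close>
    have "f (Suc ?k) = 0" if "?k < n" "\<not> Suc ?k < n"
      using that by (metis Suc_lessI mean_turns_target)
    then show ?case
      using k elim[rule_format, of t] unfolding r c by (auto simp: indicator_def)
  qed
  have "remaining (Suc t) =
      expectation (\<lambda>\<omega>. ?E (\<lambda>k. f (Suc k)) \<omega> * indicator {1} (\<xi> t \<omega>)
        + ?E (\<lambda>k. f (k - 1)) \<omega> * indicator {-1} (\<xi> t \<omega>))"
    unfolding remaining_def
    by (intro integral_cong_AE[OF _ _ ae] borel_measurable_add borel_measurable_integrable[OF int(2)]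
        borel_measurable_integrable[OF int(4)]) measurable
  also have "\<dots> = expectation (?E (\<lambda>k. f (Suc k))) * p + expectation (?E (\<lambda>k. f (k - 1))) * (1 - p)"
    using expectation_running_choice[OF up[of t], of "\<lambda>k. f (Suc k)", OF b(1)]
      expectation_running_choice[OF down[of t], of "\<lambda>k. f (k - 1)", OF b(2)] int
    by simp
  also have "\<dots> = expectation (\<lambda>\<omega>. ?E (\<lambda>k. f (Suc k)) \<omega> * p + ?E (\<lambda>k. f (k - 1)) \<omega> * (1 - p))"
    using int by simp
  also have "\<dots> = expectation (\<lambda>\<omega>. ?E f \<omega> - indicator {\<omega> \<in> space M. running t \<omega>} \<omega>)"
    using mean_turns_step[OF p(1,3), of n]
    by (intro Bochner_Integration.integral_cong) (auto simp: algebra_simps)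
  also have "\<dots> = remaining t - prob {\<omega> \<in> space M. running t \<omega>}"
    using int(5) by (simp add: remaining_def emeasure_eq_measure)
  finally show ?thesis .
qed

lemma remaining_0: "remaining 0 = f s"
proof -
  have "running 0 \<omega> \<longleftrightarrow> s < n" for \<omega>
    by (simp add: running_def)
  then have "remaining 0 = (if s < n then f s else 0)"
    by (simp add: remaining_def prob_space)
  then show ?thesis
    using start by (cases s n rule: linorder_cases) simp_all
qed

text \<open>The lower bound keeps the partial sums below \<open>f s\<close>; the upper one passes
  the decay of the probabilities on to \<open>remaining\<close>.\<close>

lemma remaining_bounds:
  "0 \<le> remaining t" "remaining t \<le> f 0 * prob {\<omega> \<in> space M. running t \<omega>}"
proof -
  have f: "0 \<le> f (chips \<xi> s \<omega> t)" if "running t \<omega>" for \<omega>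
    using that by (intro f_bounds) (auto simp: running_def intro: less_imp_le)
  then show "0 \<le> remaining t"
    unfolding remaining_def by (intro integral_nonneg_AE) auto
  have "remaining t \<le> expectation (\<lambda>\<omega>. f 0 * indicator {\<omega> \<in> space M. running t \<omega>} \<omega>)"
    unfolding remaining_def
  proof (rule integral_mono)
    show "integrable M (\<lambda>\<omega>. if running t \<omega> then f (chips \<xi> s \<omega> t) else 0)"
      by (rule integrable_const_bound[where B = "f 0"]) (use f f_bounds in auto)
    show "integrable M (\<lambda>\<omega>. f 0 * indicator {\<omega> \<in> space M. running t \<omega>} \<omega>)"
      by (intro integrable_mult_right) (simp add: emeasure_eq_measure)
  qed (use f_bounds(2) in auto)
  then show "remaining t \<le> f 0 * prob {\<omega> \<in> space M. running t \<omega>}"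
    by simp
qed

lemma running_sums: "(\<lambda>t. prob {\<omega> \<in> space M. running t \<omega>}) sums f s"
proof -
  let ?P = "\<lambda>t. prob {\<omega> \<in> space M. running t \<omega>}"
  have partial: "(\<Sum>t<N. ?P t) = f s - remaining N" for N
    by (induction N) (auto simp: remaining_0 remaining_Suc)
  have "summable ?P"
    by (rule summableI_nonneg_bounded[where x = "f s"]) (use partial remaining_bounds in auto)
  then have "(\<lambda>t. f 0 * ?P t) \<longlonglongrightarrow> f 0 * 0"
    by (intro tendsto_mult tendsto_const summable_LIMSEQ_zero)
  then have "remaining \<longlonglongrightarrow> 0"
    using remaining_bounds by (intro tendsto_sandwich[of "\<lambda>_. 0" remaining]) auto
  then have "(\<lambda>N. f s - remaining N) \<longlonglongrightarrow> f s - 0"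
    by (intro tendsto_intros)
  then show ?thesis by (simp add: sums_def partial)
qed

section \<open>From tail probabilities to the expected number of turns\<close>

lemma measurable_turns: "turns \<xi> n s \<in> M \<rightarrow>\<^sub>M count_space UNIV"
proof -
  \<comment> \<open>An extended natural is determined by the finite numbers below it, so each level
    set of \<open>turns\<close> is a countable combination of events on
    \<open>chips\<close>.\<close>
  have eq_iff: "x = y \<longleftrightarrow> (\<forall>t. enat t < x \<longleftrightarrow> enat t < y)" for x y :: enat
  proof (cases x y rule: linorder_cases)
    case less
    then show ?thesis by (cases x) auto
  next
    case greater
    then show ?thesis by (cases y) auto
  qed simp
  have "{\<omega> \<in> space M. turns \<xi> n s \<omega> = a} \<in> sets M" for a
    unfolding eq_iff less_turns_iff by measurable
  then show ?thesis
    by (subst measurable_count_space_eq_countable) (auto simp: vimage_def Int_def conj_commute)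
qed

lemma expected_turns: "expected_value M (turns \<xi> n s) = ereal (f s)"
proof -
  have "emeasure M {\<omega> \<in> space M. enat t < turns \<xi> n s \<omega>} = ennreal (prob {\<omega> \<in> space M. running t \<omega>})"
    for t
  proof -
    have "AE \<omega> in M. enat t < turns \<xi> n s \<omega> \<longleftrightarrow> running t \<omega>"
      using AE_choice_unit
    proof eventually_elim
      case (elim \<omega>)
      then show ?case
        using chips_below_target_iff[of \<xi> \<omega> s n t] start
        by (auto simp: less_turns_iff running_def)
    qed
    then have "emeasure M {\<omega> \<in> space M. enat t < turns \<xi> n s \<omega>} = emeasure M {\<omega> \<in> space M. running t \<omega>}"
      by (intro emeasure_eq_AE) (auto simp: less_turns_iff)
    then show ?thesis by (simp add: emeasure_eq_measure)
  qed
  \<comment> \<open>The tail-sum formula: the expectation is the sum over \<open>t\<close> of the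
    probabilities of \<open>turns > t\<close>.\<close>
  then have "(\<integral>\<^sup>+ \<omega>. ennreal_of_enat (turns \<xi> n s \<omega>) \<partial>M) = (\<Sum>t. ennreal (prob {\<omega> \<in> space M. running t \<omega>}))"
    by (simp add: nn_integral_enat_function[OF measurable_turns])
  also have "\<dots> = ennreal (f s)"
    using running_sums by (intro suminf_ennreal_eq) auto
  \<comment> \<open>Since \<open>f s\<close> is nonnegative, passing through \<open>ennreal\<close>
    loses nothing.\<close>
  finally show ?thesis
    using f_bounds(1)[OF start] by (simp add: expected_value_def enn2ereal_ennreal)
qed

end

theorem proposition7:
  fixes M :: "'a measure"
    and \<xi> :: "nat \<Rightarrow> 'a \<Rightarrow> int"
    and p q :: real
    and n s :: nat
  assumes "prob_space M"
    and "0 < p" and "p \<le> 1" and "p \<noteq> 1 / 2" and "q = 1 - p"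
    and "prob_space.indep_vars M (\<lambda>_. count_space UNIV) \<xi> UNIV"
    and "\<And>t. measure M {\<omega> \<in> space M. \<xi> t \<omega> = 1} = p"
    and "\<And>t. measure M {\<omega> \<in> space M. \<xi> t \<omega> = -1} = q"
    and "s \<le> n"
  shows "expected_value M (turns \<xi> n s) =
    ereal (((2 * p - 1) * real n + q * (q / p) ^ n - ((2 * p - 1) * real s + q * (q / p) ^ s))
      / (2 * p - 1)\<^sup>2)"
proof -
  interpret prob_space M by fact
  interpret pile_game M \<xi> p n s
    using assms by unfold_locales auto
  show ?thesis
    using expected_turns by (simp add: mean_turns_def \<open>q = 1 - p\<close>)
qed

end
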